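(* Let $0<q<1$. For the modular Fredholm module $(F,\pi_0,\mathcal{H})$ over $\mathcal{A}(\mathrm{SU}_q(2))$ on $\mathcal{H}=\ell^2(\mathbb{N})\otimes\ell^2(\mathbb{Z})$ with modular operator $K$ (see context), and the unitary $$V=\begin{pmatrix}-qb^* & a^* \\ a & b\end{pmatrix}\in M_2\big(\mathcal{A}(\mathrm{SU}_q(2))\big),$$ the equivariant pairing between the class of the Chern character $\mathrm{Ch}_3$ and the class of $V$ is nontrivial and equal to $q$: $$\langle[\mathrm{Ch}_3],[V]\rangle=q.$$
   Context: $\mathcal{A}(\mathrm{SU}_q(2))$ is the universal unital $*$-algebra generated by $a,b$ with relations $ba=qab$, $bb^*=b^*b$, $b^*a=qab^*$, $aa^*+bb^*=1$, $a^*a+q^2bb^*=1$. On $\mathcal{H}=\ell^2(\mathbb{N})\otimes\ell^2(\mathbb{Z})$ with orthonormal basis $e_{k,l}$, $k\ge0$, $l\in\mathbb{Z}$: $\pi_0(a)e_{k,l}=\sqrt{1-q^{2k+2}}\,e_{k+1,l}$, $\pi_0(b)e_{k,l}=q^ke_{k,l+1}$, $Fe_{k,l}=\mathrm{sign}(l)e_{k,l}$ with $\mathrm{sign}(0)=1$, $Ke_{k,l}=q^{-2k}e_{k,l}$. Elements of the algebra are identified with their images under $\pi_0$. The modular operator on $\mathcal{H}\otimes\mathbb{C}^2$ is $\tilde K=K\otimes\begin{pmatrix}q^{-1}&0\\0&q\end{pmatrix}$; $V$ commutes with $\tilde K$. Writing $F$ also for $F\otimes1$ on $\mathcal{H}\otimes\mathbb{C}^2$,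 the equivariant pairing is normalized as $$\langle[\mathrm{Ch}_3],[V]\rangle=\frac{(-1)^2}{2^4}\,\mathrm{Tr}_{\mathcal{H}\otimes\mathbb{C}^2}\big(\tilde K F[F,V][F,V^*][F,V][F,V^*]\big).$$ *)

theory Defs
  imports "HOL-Analysis.Analysis"
begin

section \<open>The complex Hilbert space of square-summable families\<close>

definition square_summable :: "('i \<Rightarrow> complex) \<Rightarrow> bool" where
  "square_summable f \<longleftrightarrow> (\<lambda>i. (cmod (f i))\<^sup>2) summable_on UNIV"

lemma square_summable_zero: "square_summable (\<lambda>_. 0)"
  by (simp add: square_summable_def)

lemma square_summable_mono:
  assumes "square_summable f" "\<And>i. cmod (g i) \<le> C * cmod (f i)"
  shows "square_summable g"
proof -
  have s: "(\<lambda>i. C\<^sup>2 * (cmod (f i))\<^sup>2) summable_on UNIV"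
    using assms(1) unfolding square_summable_def by (rule summable_on_cmult_right)
  show ?thesis
    unfolding square_summable_def
  proof (rule summable_on_comparison_test[OF s])
    fix i
    have "(cmod (g i))\<^sup>2 \<le> (C * cmod (f i))\<^sup>2"
      using assms(2)[of i] by (intro power_mono) auto
    then show "(cmod (g i))\<^sup>2 \<le> C\<^sup>2 * (cmod (f i))\<^sup>2"
      by (simp add: power_mult_distrib)
  qed auto
qed

lemma square_summable_add:
  assumes "square_summable f" "square_summable g"
  shows "square_summable (\<lambda>i. f i + g i)"
proof -
  have s: "(\<lambda>i. 2 * (cmod (f i))\<^sup>2 + 2 * (cmod (g i))\<^sup>2) summable_on UNIV"
    using assms unfolding square_summable_def
    by (intro summable_on_add summable_on_cmult_right)
  show ?thesis
    unfolding square_summable_def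
  proof (rule summable_on_comparison_test[OF s])
    fix i
    have "(cmod (f i + g i))\<^sup>2 \<le> (cmod (f i) + cmod (g i))\<^sup>2"
      by (intro power_mono norm_triangle_ineq) auto
    also have "\<dots> \<le> 2 * (cmod (f i))\<^sup>2 + 2 * (cmod (g i))\<^sup>2"
      using zero_le_power2[of "cmod (f i) - cmod (g i)"]
      by (simp add: power2_sum power2_diff)
    finally show "(cmod (f i + g i))\<^sup>2 \<le> 2 * (cmod (f i))\<^sup>2 + 2 * (cmod (g i))\<^sup>2" .
  qed auto
qed

lemma square_summable_scale: "square_summable f \<Longrightarrow> square_summable (\<lambda>i. c * f i)"
  by (rule square_summable_mono[where C = "cmod c"]) (auto simp: norm_mult)

lemma square_summable_reindex:
  assumes "square_summable f" "inj g"
  shows "square_summable (\<lambda>i. f (g i))"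
proof -
  have "(\<lambda>j. (cmod (f j))\<^sup>2) summable_on range g"
    using assms(1) unfolding square_summable_def by (rule summable_on_subset_banach) auto
  then show ?thesis
    using summable_on_reindex[OF assms(2), of "\<lambda>j. (cmod (f j))\<^sup>2"]
    by (simp add: square_summable_def o_def)
qed

lemma square_summable_finite:
  assumes "finite {i. f i \<noteq> 0}"
  shows "square_summable f"
proof -
  have "(\<lambda>i. (cmod (f i))\<^sup>2) summable_on {i. f i \<noteq> 0}"
    using assms by simp
  then show ?thesis
    unfolding square_summable_def
    by (subst summable_on_cong_neutral[where T = "{i. f i \<noteq> 0}"]) auto
qed

lemma square_summable_product:
  assumes "square_summable f" "square_summable g"
  shows "(\<lambda>i. norm (cnj (f i) * g i)) summable_on UNIV"
proof -
  have s: "(\<lambda>i. (cmod (f i))\<^sup>2 + (cmod (g i))\<^sup>2) summable_on UNIV"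
    using assms unfolding square_summable_def by (intro summable_on_add)
  show ?thesis
  proof (rule summable_on_comparison_test[OF s])
    fix i
    show "norm (cnj (f i) * g i) \<le> (cmod (f i))\<^sup>2 + (cmod (g i))\<^sup>2"
      using zero_le_power2[of "cmod (f i) - cmod (g i)"]
        mult_nonneg_nonneg[OF norm_ge_zero[of "f i"] norm_ge_zero[of "g i"]]
      unfolding norm_mult power2_diff complex_mod_cnj by linarith
  qed auto
qed

typedef 'i ell2 = "{f :: 'i \<Rightarrow> complex. square_summable f}"
  morphisms coord Abs_ell2
  using square_summable_zero by blast

lemma coord_square_summable: "square_summable (coord x)"
  using coord by auto

lemma ell2_eqI: "(\<And>i. coord x i = coord y i) \<Longrightarrow> x = y"
  by (metis coord_inject ext)

text \<open>Families that are not square-summable are sent to \<open>0\<close>. Only the unbounded operators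
  \<open>K\<close> and \<open>K \<otimes> diag(q\<^sup>-\<^sup>1, q)\<close> make use of this convention; their natural domains are
  defined separately.\<close>

definition ell2_of :: "('i \<Rightarrow> complex) \<Rightarrow> 'i ell2" where
  "ell2_of f = (if square_summable f then Abs_ell2 f else Abs_ell2 (\<lambda>_. 0))"

lemma coord_ell2_of: "square_summable f \<Longrightarrow> coord (ell2_of f) = f"
  by (simp add: ell2_of_def Abs_ell2_inverse)

definition scaleC :: "complex \<Rightarrow> 'i ell2 \<Rightarrow> 'i ell2"  (infixr "*\<^sub>C" 75) where
  "c *\<^sub>C x = ell2_of (\<lambda>i. c * coord x i)"

definition cinner :: "'i ell2 \<Rightarrow> 'i ell2 \<Rightarrow> complex" where
  "cinner x y = (\<Sum>\<^sub>\<infinity>i. cnj (coord x i) * coord y i)"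

definition ket :: "'i \<Rightarrow> 'i ell2" where
  "ket i = ell2_of (\<lambda>j. if j = i then 1 else 0)"

lemma coord_scaleC [simp]: "coord (c *\<^sub>C x) i = c * coord x i"
  by (simp add: scaleC_def coord_ell2_of square_summable_scale coord_square_summable)

lemma coord_ket: "coord (ket i) j = (if j = i then 1 else 0)"
  unfolding ket_def by (subst coord_ell2_of) (auto intro!: square_summable_finite)

lemma cinner_summable: "(\<lambda>i. cnj (coord x i) * coord y i) summable_on UNIV"
  by (rule abs_summable_summable[OF square_summable_product])
    (simp_all add: coord_square_summable)

lemma cinner_ket: "cinner (ket i) x = coord x i"
proof -
  have "cinner (ket i) x = (\<Sum>\<^sub>\<infinity>j\<in>{i}. cnj (coord (ket i) j) * coord x j)"
    unfolding cinner_def by (rule infsum_cong_neutral) (auto simp: coord_ket)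
  then show ?thesis
    by (simp add: coord_ket)
qed

lemma cinner_commute: "cinner y x = cnj (cinner x y)"
  by (simp add: cinner_def mult.commute flip: infsum_cnj)

lemma cinner_scaleC_right: "cinner x (c *\<^sub>C y) = c * cinner x y"
  by (simp add: cinner_def mult.left_commute infsum_cmult_right')

lemma cinner_scaleC_left: "cinner (c *\<^sub>C x) y = cnj c * cinner x y"
  by (simp add: cinner_def mult.assoc infsum_cmult_right')

instantiation ell2 :: (type) real_inner
begin

definition "0 = ell2_of (\<lambda>_. 0)"
definition "x + y = ell2_of (\<lambda>i. coord x i + coord y i)"
definition "- x = (- 1) *\<^sub>C x" for x :: "'a ell2"
definition "x - y = x + (- y)" for x y :: "'a ell2"
definition "r *\<^sub>R x = complex_of_real r *\<^sub>C x" for x :: "'a ell2"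
definition "inner x y = Re (cinner x y)" for x y :: "'a ell2"
definition "norm x = sqrt (inner x x)" for x :: "'a ell2"
definition "sgn x = inverse (norm x) *\<^sub>R x" for x :: "'a ell2"
definition "dist x y = norm (x - y)" for x y :: "'a ell2"
definition "(uniformity :: ('a ell2 \<times> 'a ell2) filter) =
  (INF e\<in>{0<..}. principal {(x, y). dist x y < e})"
definition "open U \<longleftrightarrow> (\<forall>x\<in>U. \<forall>\<^sub>F (x', y) in uniformity. x' = x \<longrightarrow> y \<in> U)"
  for U :: "'a ell2 set"

lemma coord_zero: "coord (0 :: 'a ell2) i = 0"
  by (simp add: zero_ell2_def coord_ell2_of square_summable_zero)

lemma coord_add: "coord (x + y :: 'a ell2) i = coord x i + coord y i"
  by (simp add: plus_ell2_def coord_ell2_of square_summable_add coord_square_summable)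

lemma coord_uminus: "coord (- x :: 'a ell2) i = - coord x i"
  by (simp add: uminus_ell2_def)

lemma coord_diff: "coord (x - y :: 'a ell2) i = coord x i - coord y i"
  by (simp add: minus_ell2_def coord_add coord_uminus)

lemma coord_scaleR: "coord (r *\<^sub>R x :: 'a ell2) i = of_real r * coord x i"
  by (simp add: scaleR_ell2_def)

lemma cinner_add_left: "cinner (x + y :: 'a ell2) z = cinner x z + cinner y z"
  by (simp add: cinner_def coord_add distrib_right infsum_add cinner_summable)

lemma cinner_self: "cinner x x = complex_of_real (\<Sum>\<^sub>\<infinity>i. (cmod (coord x i))\<^sup>2)"
proof -
  have sm: "(\<lambda>i. (cmod (coord x i))\<^sup>2) summable_on UNIV"
    using coord_square_summable[of x] by (simp add: square_summable_def)
  have "(\<lambda>i. cnj (coord x i) * coord x i) = (\<lambda>i. complex_of_real ((cmod (coord x i))\<^sup>2))"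
    by (rule ext) (simp only: complex_norm_square mult.commute)
  then show ?thesis
    unfolding cinner_def
    by (simp only: infsumI[OF iffD2[OF has_sum_of_real_iff has_sum_infsum[OF sm]]])
qed

instance
proof
  fix x y z :: "'a ell2" and r s :: real
  show "x + y + z = x + (y + z)" "x + y = y + x" "0 + x = x" "- x + x = 0" "x - y = x + - y"
    by (auto intro!: ell2_eqI simp: coord_add coord_zero coord_uminus coord_diff)
  show "r *\<^sub>R (x + y) = r *\<^sub>R x + r *\<^sub>R y" "(r + s) *\<^sub>R x = r *\<^sub>R x + s *\<^sub>R x"
    "r *\<^sub>R s *\<^sub>R x = (r * s) *\<^sub>R x" "1 *\<^sub>R x = x"
    by (auto intro!: ell2_eqI simp: coord_add coord_scaleR algebra_simps)
  show "inner x y = inner y x"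
    using cinner_commute[of x y] by (simp add: inner_ell2_def)
  show "inner (x + y) z = inner x z + inner y z"
    by (simp add: inner_ell2_def cinner_add_left)
  show "inner (r *\<^sub>R x) y = r * inner x y"
    by (simp add: inner_ell2_def scaleR_ell2_def cinner_scaleC_left)
  show "0 \<le> inner x x"
    by (simp add: inner_ell2_def cinner_self infsum_nonneg)
  have sm: "(\<lambda>i. (cmod (coord x i))\<^sup>2) summable_on UNIV"
    using coord_square_summable[of x] by (simp add: square_summable_def)
  show "inner x x = 0 \<longleftrightarrow> x = 0"
  proof
    assume "inner x x = 0"
    then have "(\<Sum>\<^sub>\<infinity>i. (cmod (coord x i))\<^sup>2) = 0"
      by (simp add: inner_ell2_def cinner_self)
    then have "(cmod (coord x i))\<^sup>2 = 0" for i
      using nonneg_infsum_le_0D[OF _ sm, of i] by simp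
    then show "x = 0"
      by (intro ell2_eqI) (simp add: coord_zero)
  qed (simp add: inner_ell2_def cinner_self coord_zero)
qed (simp_all add: norm_ell2_def sgn_ell2_def dist_ell2_def uniformity_ell2_def open_ell2_def)

end

lemmas coord_simps [simp] =
  coord_zero coord_add coord_uminus coord_diff coord_scaleR

section \<open>Operators\<close>

definition bounded_clinear :: "('i ell2 \<Rightarrow> 'j ell2) \<Rightarrow> bool" where
  "bounded_clinear T \<longleftrightarrow> bounded_linear T \<and> (\<forall>c x. T (c *\<^sub>C x) = c *\<^sub>C T x)"

definition adjoint_pair :: "('i ell2 \<Rightarrow> 'j ell2) \<Rightarrow> ('j ell2 \<Rightarrow> 'i ell2) \<Rightarrow> bool" where
  "adjoint_pair S T \<longleftrightarrow> (\<forall>x y. cinner (S x) y = cinner x (T y))"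

definition adj :: "('i ell2 \<Rightarrow> 'j ell2) \<Rightarrow> 'j ell2 \<Rightarrow> 'i ell2" where
  "adj S = (THE T. adjoint_pair S T)"

definition positive_op :: "('i ell2 \<Rightarrow> 'i ell2) \<Rightarrow> bool" where
  "positive_op P \<longleftrightarrow> bounded_clinear P \<and>
     (\<forall>x. Im (cinner x (P x)) = 0 \<and> 0 \<le> Re (cinner x (P x)))"

text \<open>The operator \<open>P\<close> below is the absolute value \<open>|T|\<close>, the unique positive square root
  of \<open>T\<^sup>* T\<close>.\<close>

definition trace_class :: "('i ell2 \<Rightarrow> 'i ell2) \<Rightarrow> bool" where
  "trace_class T \<longleftrightarrow> bounded_clinear T \<and>
     (\<exists>P. positive_op P \<and> P \<circ> P = adj T \<circ> T \<and>
          (\<lambda>i. cinner (ket i) (P (ket i))) summable_on UNIV)"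

text \<open>Since the trace is \<open>0\<close> outside the trace class, a nonzero value of the trace
  includes the assertion that the operator is trace class.\<close>

definition op_trace :: "('i ell2 \<Rightarrow> 'i ell2) \<Rightarrow> complex" where
  "op_trace T = (if trace_class T then \<Sum>\<^sub>\<infinity>i. cinner (ket i) (T (ket i)) else 0)"

definition commutator :: "('a \<Rightarrow> 'a) \<Rightarrow> ('a \<Rightarrow> 'a) \<Rightarrow> 'a \<Rightarrow> 'a::ab_group_add" where
  "commutator S T = (\<lambda>x. S (T x) - T (S x))"

lemma adjoint_pair_unique: "adjoint_pair S T \<Longrightarrow> adjoint_pair S T' \<Longrightarrow> T = T'"
  unfolding adjoint_pair_def by (intro ext ell2_eqI) (metis cinner_ket)

lemma adj_eqI: "adjoint_pair S T \<Longrightarrow> adj S = T"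
  unfolding adj_def using adjoint_pair_unique by blast

lemma adjoint_pair_sym: "adjoint_pair S T \<Longrightarrow> adjoint_pair T S"
  unfolding adjoint_pair_def by (metis cinner_commute)

lemma coord_adjoint_pair: "adjoint_pair S T \<Longrightarrow> coord (S x) i = cnj (cinner x (T (ket i)))"
  by (metis adjoint_pair_def cinner_commute cinner_ket complex_cnj_cnj)

lemma adjoint_pair_linear:
  assumes "adjoint_pair S T"
  shows "S (x + y) = S x + S y" "S (c *\<^sub>C x) = c *\<^sub>C S x"
  by (auto intro!: ell2_eqI
      simp: coord_adjoint_pair[OF assms] cinner_add_left cinner_scaleC_left)

subsection \<open>Matrices of operators on \<open>\<ell>\<^sup>2(I) \<otimes> \<complex>\<^sup>n = \<ell>\<^sup>2(I \<times> n)\<close>\<close>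

definition component :: "'n \<Rightarrow> ('i \<times> 'n) ell2 \<Rightarrow> 'i ell2" where
  "component r x = ell2_of (\<lambda>i. coord x (i, r))"

definition matrix_op ::
    "('i ell2 \<Rightarrow> 'i ell2) ^'n ^'n \<Rightarrow> ('i \<times> 'n::finite) ell2 \<Rightarrow> ('i \<times> 'n) ell2" where
  "matrix_op M x = ell2_of (\<lambda>(i, r). \<Sum>s\<in>UNIV. coord ((M $ r $ s) (component s x)) i)"

definition tensor_op ::
    "('i ell2 \<Rightarrow> 'i ell2) \<Rightarrow> complex ^'n ^'n \<Rightarrow> ('i \<times> 'n::finite) ell2 \<Rightarrow> ('i \<times> 'n) ell2" where
  "tensor_op T D = matrix_op (\<chi> r s. (\<lambda>x. (D $ r $ s) *\<^sub>C T x))"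

lemma coord_component: "coord (component r x) i = coord x (i, r)"
proof -
  have "square_summable (\<lambda>i. coord x (i, r))"
    by (rule square_summable_reindex[OF coord_square_summable, of "\<lambda>i. (i, r)"])
      (simp add: inj_def)
  then show ?thesis
    by (simp add: component_def coord_ell2_of)
qed

lemma square_summable_matrix:
  fixes f :: "'i \<Rightarrow> 'n::finite \<Rightarrow> complex"
  assumes "\<And>r. square_summable (\<lambda>i. f i r)"
  shows "square_summable (\<lambda>(i, r). f i r)"
proof -
  have "(\<lambda>p. (cmod (f (fst p) (snd p)))\<^sup>2) summable_on (UNIV \<times> {r})" for r
  proof -
    have "(\<lambda>p. (cmod (f (fst p) (snd p)))\<^sup>2) summable_on range (\<lambda>i. (i, r))"
      using assms[of r]
        summable_on_reindex[of "\<lambda>i. (i, r)" UNIV "\<lambda>p. (cmod (f (fst p) (snd p)))\<^sup>2"]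
      by (simp add: square_summable_def o_def inj_on_def)
    moreover have "range (\<lambda>i. (i, r)) = UNIV \<times> {r}"
      by auto
    ultimately show ?thesis
      by metis
  qed
  moreover have "(\<Union>r. UNIV \<times> {r}) = (UNIV :: ('i \<times> 'n) set)"
    by auto
  ultimately have "(\<lambda>p. (cmod (f (fst p) (snd p)))\<^sup>2) summable_on (UNIV :: ('i \<times> 'n) set)"
    using summable_on_finite_union_disjoint[where A = UNIV and B = "\<lambda>r::'n. UNIV \<times> {r}"
        and f = "\<lambda>p. (cmod (f (fst p) (snd p)))\<^sup>2"]
    by auto
  then show ?thesis
    by (simp add: square_summable_def case_prod_beta)
qed

lemma square_summable_sum:
  "finite A \<Longrightarrow> (\<And>s. s \<in> A \<Longrightarrow> square_summable (f s)) \<Longrightarrow> square_summable (\<lambda>i. \<Sum>s\<in>A. f s i)"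
  by (induction A rule: finite_induct) (auto intro: square_summable_add square_summable_zero)

lemma component_matrix_op: "component r (matrix_op M x) = (\<Sum>s\<in>UNIV. (M $ r $ s) (component s x))"
proof -
  have coord_sum: "coord (\<Sum>s\<in>A. g s) i = (\<Sum>s\<in>A. coord (g s) i)" for A :: "'b set" and g i
    by (induction A rule: infinite_finite_induct) auto
  have "square_summable (\<lambda>(i, r). \<Sum>s\<in>UNIV. coord ((M $ r $ s) (component s x)) i)"
    by (intro square_summable_matrix square_summable_sum coord_square_summable) auto
  then show ?thesis
    by (intro ell2_eqI) (simp add: coord_component matrix_op_def coord_ell2_of coord_sum)
qed

lemma ell2_component_eqI: "(\<And>r. component r x = component r y) \<Longrightarrow> x = y"
  by (rule ell2_eqI) (metis coord_component prod.collapse)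

section \<open>The universal unital \<open>*\<close>-algebra \<open>\<A>(SU\<^sub>q(2))\<close>\<close>

datatype suq2_term =
    Gen_a | Gen_b | Unit | Null
  | Add suq2_term suq2_term
  | Mul suq2_term suq2_term
  | Scale complex suq2_term
  | Star suq2_term

text \<open>The least congruence containing the axioms of unital complex \<open>*\<close>-algebras and the
  defining relations.\<close>

inductive suq2_eq :: "real \<Rightarrow> suq2_term \<Rightarrow> suq2_term \<Rightarrow> bool" for q :: real where
  refl: "suq2_eq q s s"
| sym: "suq2_eq q s t \<Longrightarrow> suq2_eq q t s"
| trans: "suq2_eq q s t \<Longrightarrow> suq2_eq q t u \<Longrightarrow> suq2_eq q s u"
| Add_cong: "suq2_eq q s s' \<Longrightarrow> suq2_eq q t t' \<Longrightarrow> suq2_eq q (Add s t) (Add s' t')"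
| Mul_cong: "suq2_eq q s s' \<Longrightarrow> suq2_eq q t t' \<Longrightarrow> suq2_eq q (Mul s t) (Mul s' t')"
| Scale_cong: "suq2_eq q s s' \<Longrightarrow> suq2_eq q (Scale c s) (Scale c s')"
| Star_cong: "suq2_eq q s s' \<Longrightarrow> suq2_eq q (Star s) (Star s')"
| Add_assoc: "suq2_eq q (Add (Add s t) u) (Add s (Add t u))"
| Add_commute: "suq2_eq q (Add s t) (Add t s)"
| Add_Null: "suq2_eq q (Add Null s) s"
| Add_minus: "suq2_eq q (Add s (Scale (- 1) s)) Null"
| Scale_add_right: "suq2_eq q (Scale c (Add s t)) (Add (Scale c s) (Scale c t))"
| Scale_add_left: "suq2_eq q (Scale (c + d) s) (Add (Scale c s) (Scale d s))"
| Scale_Scale: "suq2_eq q (Scale c (Scale d s)) (Scale (c * d) s)"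
| Scale_1: "suq2_eq q (Scale 1 s) s"
| Mul_assoc: "suq2_eq q (Mul (Mul s t) u) (Mul s (Mul t u))"
| Mul_Unit_left: "suq2_eq q (Mul Unit s) s"
| Mul_Unit_right: "suq2_eq q (Mul s Unit) s"
| Mul_Add_left: "suq2_eq q (Mul (Add s t) u) (Add (Mul s u) (Mul t u))"
| Mul_Add_right: "suq2_eq q (Mul s (Add t u)) (Add (Mul s t) (Mul s u))"
| Mul_Scale_left: "suq2_eq q (Mul (Scale c s) t) (Scale c (Mul s t))"
| Mul_Scale_right: "suq2_eq q (Mul s (Scale c t)) (Scale c (Mul s t))"
| Star_Star: "suq2_eq q (Star (Star s)) s"
| Star_Add: "suq2_eq q (Star (Add s t)) (Add (Star s) (Star t))"
| Star_Scale: "suq2_eq q (Star (Scale c s)) (Scale (cnj c) (Star s))"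
| Star_Mul: "suq2_eq q (Star (Mul s t)) (Mul (Star t) (Star s))"
| ba: "suq2_eq q (Mul Gen_b Gen_a) (Scale (of_real q) (Mul Gen_a Gen_b))"
| b_normal: "suq2_eq q (Mul Gen_b (Star Gen_b)) (Mul (Star Gen_b) Gen_b)"
| b_star_a: "suq2_eq q (Mul (Star Gen_b) Gen_a) (Scale (of_real q) (Mul Gen_a (Star Gen_b)))"
| a_a_star: "suq2_eq q (Add (Mul Gen_a (Star Gen_a)) (Mul Gen_b (Star Gen_b))) Unit"
| a_star_a: "suq2_eq q (Add (Mul (Star Gen_a) Gen_a)
    (Scale (of_real (q\<^sup>2)) (Mul Gen_b (Star Gen_b)))) Unit"

definition suq2_rel :: "real \<Rightarrow> (suq2_term \<times> suq2_term) set" where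
  "suq2_rel q = {(s, t). suq2_eq q s t}"

definition suq2 :: "real \<Rightarrow> suq2_term set set" where
  "suq2 q = UNIV // suq2_rel q"

definition suq2_class :: "real \<Rightarrow> suq2_term \<Rightarrow> suq2_term set" where
  "suq2_class q t = suq2_rel q `` {t}"

definition suq2_add :: "real \<Rightarrow> suq2_term set \<Rightarrow> suq2_term set \<Rightarrow> suq2_term set" where
  "suq2_add q X Y = (\<Union>s\<in>X. \<Union>t\<in>Y. suq2_class q (Add s t))"

definition suq2_mult :: "real \<Rightarrow> suq2_term set \<Rightarrow> suq2_term set \<Rightarrow> suq2_term set" where
  "suq2_mult q X Y = (\<Union>s\<in>X. \<Union>t\<in>Y. suq2_class q (Mul s t))"

definition suq2_scale :: "real \<Rightarrow> complex \<Rightarrow> suq2_term set \<Rightarrow> suq2_term set" where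
  "suq2_scale q c X = (\<Union>s\<in>X. suq2_class q (Scale c s))"

definition suq2_star :: "real \<Rightarrow> suq2_term set \<Rightarrow> suq2_term set" where
  "suq2_star q X = (\<Union>s\<in>X. suq2_class q (Star s))"

definition suq2_a :: "real \<Rightarrow> suq2_term set" where
  "suq2_a q = suq2_class q Gen_a"

definition suq2_b :: "real \<Rightarrow> suq2_term set" where
  "suq2_b q = suq2_class q Gen_b"

definition suq2_one :: "real \<Rightarrow> suq2_term set" where
  "suq2_one q = suq2_class q Unit"

definition suq2_zero :: "real \<Rightarrow> suq2_term set" where
  "suq2_zero q = suq2_class q Null"

lemma mem_suq2_class: "s \<in> suq2_class q t \<longleftrightarrow> suq2_eq q t s"
  by (simp add: suq2_class_def suq2_rel_def)

lemma suq2_class_eqI: "suq2_eq q s t \<Longrightarrow> suq2_class q s = suq2_class q t"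
  unfolding set_eq_iff mem_suq2_class by (metis suq2_eq.sym suq2_eq.trans)

lemma suq2_class_in: "suq2_class q t \<in> suq2 q"
  by (simp add: suq2_def suq2_class_def quotientI)

lemma suq2_ops_class:
  "suq2_add q (suq2_class q s) (suq2_class q t) = suq2_class q (Add s t)"
  "suq2_mult q (suq2_class q s) (suq2_class q t) = suq2_class q (Mul s t)"
  "suq2_scale q c (suq2_class q s) = suq2_class q (Scale c s)"
  "suq2_star q (suq2_class q s) = suq2_class q (Star s)"
proof -
  have ne: "suq2_class q s \<noteq> {}" for s
    using mem_suq2_class[of s q s] suq2_eq.refl[of q s] by blast
  have *: "(\<Union>s'\<in>suq2_class q s. f s') = f s" if "\<And>s'. suq2_eq q s s' \<Longrightarrow> f s = f s'"
    for f :: "suq2_term \<Rightarrow> suq2_term set" and s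
  proof -
    have "(\<Union>s'\<in>suq2_class q s. f s') = (\<Union>s'\<in>suq2_class q s. f s)"
      using that[symmetric] by (intro SUP_cong) (simp_all only: mem_suq2_class)
    then show ?thesis
      by (simp add: ne)
  qed
  have **: "(\<Union>s'\<in>suq2_class q s. \<Union>t'\<in>suq2_class q t. f s' t') = f s t"
    if "\<And>s' t'. suq2_eq q s s' \<Longrightarrow> suq2_eq q t t' \<Longrightarrow> f s t = f s' t'"
    for f :: "suq2_term \<Rightarrow> suq2_term \<Rightarrow> suq2_term set"
  proof -
    have "(\<Union>s'\<in>suq2_class q s. \<Union>t'\<in>suq2_class q t. f s' t') =
        (\<Union>s'\<in>suq2_class q s. \<Union>t'\<in>suq2_class q t. f s t)"
      using that[symmetric] by (intro SUP_cong) (simp_all only: mem_suq2_class)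
    then show ?thesis
      by (simp add: ne)
  qed
  show "suq2_add q (suq2_class q s) (suq2_class q t) = suq2_class q (Add s t)"
    unfolding suq2_add_def by (rule **) (rule suq2_class_eqI[OF suq2_eq.Add_cong])
  show "suq2_mult q (suq2_class q s) (suq2_class q t) = suq2_class q (Mul s t)"
    unfolding suq2_mult_def by (rule **) (rule suq2_class_eqI[OF suq2_eq.Mul_cong])
  show "suq2_scale q c (suq2_class q s) = suq2_class q (Scale c s)"
    unfolding suq2_scale_def by (rule *) (rule suq2_class_eqI[OF suq2_eq.Scale_cong])
  show "suq2_star q (suq2_class q s) = suq2_class q (Star s)"
    unfolding suq2_star_def by (rule *) (rule suq2_class_eqI[OF suq2_eq.Star_cong])
qed

section \<open>The unitary \<open>V\<close> in \<open>M\<^sub>2(\<A>(SU\<^sub>q(2)))\<close>\<close>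

definition M2_mult ::
    "real \<Rightarrow> suq2_term set ^2 ^2 \<Rightarrow> suq2_term set ^2 ^2 \<Rightarrow> suq2_term set ^2 ^2" where
  "M2_mult q M N = (\<chi> i j. suq2_add q (suq2_mult q (M $ i $ 1) (N $ 1 $ j))
                                     (suq2_mult q (M $ i $ 2) (N $ 2 $ j)))"

definition M2_star :: "real \<Rightarrow> suq2_term set ^2 ^2 \<Rightarrow> suq2_term set ^2 ^2" where
  "M2_star q M = (\<chi> i j. suq2_star q (M $ j $ i))"

definition M2_one :: "real \<Rightarrow> suq2_term set ^2 ^2" where
  "M2_one q = (\<chi> i j. if i = j then suq2_one q else suq2_zero q)"

definition suq2_V :: "real \<Rightarrow> suq2_term set ^2 ^2" where
  "suq2_V q = (\<chi> i j.
     if i = 1 then (if j = 1 then suq2_scale q (- of_real q) (suq2_star q (suq2_b q))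
                    else suq2_star q (suq2_a q))
     else (if j = 1 then suq2_a q else suq2_b q))"

section \<open>The representation \<open>\<pi>\<^sub>0\<close> and the operators \<open>F\<close> and \<open>K\<close>\<close>

text \<open>\<open>\<ell>\<^sup>2(\<nat>) \<otimes> \<ell>\<^sup>2(\<int>)\<close> is \<open>\<ell>\<^sup>2(\<nat> \<times> \<int>)\<close> with \<open>e\<^sub>k\<^sub>,\<^sub>l\<close> being \<^term>\<open>ket (k, l)\<close>.\<close>

type_synonym hilb = "(nat \<times> int) ell2"

text \<open>The operators are given by their action on coordinates; their values on the
  basis are \<open>op_a_ket\<close>, \<open>op_b_ket\<close>, \<open>op_F_ket\<close> and \<open>op_K_ket\<close> below.\<close>

definition op_a :: "real \<Rightarrow> hilb \<Rightarrow> hilb" where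
  "op_a q x = ell2_of (\<lambda>(k, l).
     if k = 0 then 0 else of_real (sqrt (1 - q ^ (2 * k))) * coord x (k - 1, l))"

definition op_b :: "real \<Rightarrow> hilb \<Rightarrow> hilb" where
  "op_b q x = ell2_of (\<lambda>(k, l). of_real (q ^ k) * coord x (k, l - 1))"

primrec suq2_eval :: "real \<Rightarrow> suq2_term \<Rightarrow> hilb \<Rightarrow> hilb" where
  "suq2_eval q Gen_a = op_a q"
| "suq2_eval q Gen_b = op_b q"
| "suq2_eval q Unit = id"
| "suq2_eval q Null = (\<lambda>_. 0)"
| "suq2_eval q (Add s t) = (\<lambda>x. suq2_eval q s x + suq2_eval q t x)"
| "suq2_eval q (Mul s t) = suq2_eval q s \<circ> suq2_eval q t"
| "suq2_eval q (Scale c s) = (\<lambda>x. c *\<^sub>C suq2_eval q s x)"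
| "suq2_eval q (Star s) = adj (suq2_eval q s)"

text \<open>The set \<^term>\<open>suq2_eval q ` X\<close> is a singleton for \<^term>\<open>X \<in> suq2 q\<close>, see
  \<open>suq2_eval_cong\<close> and \<open>pi0_class\<close> below.\<close>

definition pi0 :: "real \<Rightarrow> suq2_term set \<Rightarrow> hilb \<Rightarrow> hilb" where
  "pi0 q X = the_elem (suq2_eval q ` X)"

definition sign0 :: "int \<Rightarrow> complex" where
  "sign0 l = (if l \<ge> 0 then 1 else - 1)"

definition op_F :: "hilb \<Rightarrow> hilb" where
  "op_F x = ell2_of (\<lambda>(k, l). sign0 l * coord x (k, l))"

text \<open>\<open>K\<close> is unbounded: \<open>op_K q\<close> is meaningful on \<open>K_domain q\<close> only.\<close>

definition K_domain :: "real \<Rightarrow> hilb set" where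
  "K_domain q = {x. square_summable (\<lambda>(k, l). of_real (q powi (- 2 * int k)) * coord x (k, l))}"

definition op_K :: "real \<Rightarrow> hilb \<Rightarrow> hilb" where
  "op_K q x = ell2_of (\<lambda>(k, l). of_real (q powi (- 2 * int k)) * coord x (k, l))"

section \<open>The equivariant pairing\<close>

type_synonym hilb2 = "((nat \<times> int) \<times> 2) ell2"

definition M2_pi0 :: "real \<Rightarrow> suq2_term set ^2 ^2 \<Rightarrow> hilb2 \<Rightarrow> hilb2" where
  "M2_pi0 q M = matrix_op (\<chi> i j. pi0 q (M $ i $ j))"

definition op_F2 :: "hilb2 \<Rightarrow> hilb2" where
  "op_F2 = tensor_op op_F (mat 1)"

definition op_K2 :: "real \<Rightarrow> hilb2 \<Rightarrow> hilb2" where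
  "op_K2 q = tensor_op (op_K q)
     (vector [vector [of_real (inverse q), 0], vector [0, of_real q]])"

definition K2_domain :: "real \<Rightarrow> hilb2 set" where
  "K2_domain q = {x. \<forall>r. component r x \<in> K_domain q}"

definition chern3_op :: "real \<Rightarrow> suq2_term set ^2 ^2 \<Rightarrow> hilb2 \<Rightarrow> hilb2" where
  "chern3_op q V = op_F2
      \<circ> commutator op_F2 (M2_pi0 q V) \<circ> commutator op_F2 (M2_pi0 q (M2_star q V))
      \<circ> commutator op_F2 (M2_pi0 q V) \<circ> commutator op_F2 (M2_pi0 q (M2_star q V))"

text \<open>The composition with the unbounded operator is legitimate for \<open>V = suq2_V q\<close>: the range
  of \<open>chern3_op q V\<close> is contained in \<open>K2_domain q\<close> (\<open>chern3_op_in_domain\<close> below).\<close>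

definition chern3_pairing :: "real \<Rightarrow> suq2_term set ^2 ^2 \<Rightarrow> complex" where
  "chern3_pairing q V = (- 1) ^ 2 / 2 ^ 4 * op_trace (op_K2 q \<circ> chern3_op q V)"

section \<open>Well-definedness and basic properties\<close>

context
  fixes q :: real
  assumes q: "0 < q" "q < 1"
begin

lemma coord_op_a:
  "coord (op_a q x) (k, l) =
    (if k = 0 then 0 else of_real (sqrt (1 - q ^ (2 * k))) * coord x (k - 1, l))"
proof -
  define g where "g = (\<lambda>(k::nat, l::int). if k = 0 then 0 else coord x (k - 1, l))"
  have "square_summable (\<lambda>(k, l). coord x (k, l))"
    using coord_square_summable[of x] by simp
  then have sx: "(\<lambda>p. (cmod (coord x p))\<^sup>2) summable_on UNIV"
    by (simp add: square_summable_def)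
  have inj: "inj (\<lambda>(k::nat, l::int). (Suc k, l))"
    by (auto simp: inj_def)
  have "(\<lambda>p. (cmod (g p))\<^sup>2) summable_on range (\<lambda>(k, l). (Suc k, l))"
    using sx summable_on_reindex[OF inj, of "\<lambda>p. (cmod (g p))\<^sup>2"]
    by (simp add: g_def o_def case_prod_beta)
  then have "square_summable g"
    unfolding square_summable_def
    by (rule iffD1[OF summable_on_cong_neutral, rotated -1])
      (auto simp: g_def image_iff gr0_conv_Suc split: if_splits)
  then have "square_summable (\<lambda>(k, l).
      if k = 0 then 0 else of_real (sqrt (1 - q ^ (2 * k))) * coord x (k - 1, l))"
  proof (rule square_summable_mono[where C = 1])
    fix p :: "nat \<times> int"
    have "0 \<le> 1 - q ^ (2 * fst p)" "1 - q ^ (2 * fst p) \<le> 1"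
      using q by (simp_all add: power_le_one)
    then have "\<bar>sqrt (1 - q ^ (2 * fst p))\<bar> \<le> 1"
      by simp
    then show "cmod (case p of (k, l) \<Rightarrow>
        if k = 0 then 0 else of_real (sqrt (1 - q ^ (2 * k))) * coord x (k - 1, l)) \<le> 1 * cmod (g p)"
      by (auto simp: g_def case_prod_beta norm_mult intro: mult_left_le_one_le)
  qed
  then show ?thesis
    by (simp add: op_a_def coord_ell2_of)
qed

lemma square_summable_weighted:
  assumes "inj g" "\<And>p. cmod (w p) \<le> 1"
  shows "square_summable (\<lambda>p. w p * coord x (g p))"
  using square_summable_reindex[OF coord_square_summable assms(1)]
  by (rule square_summable_mono[where C = 1])
    (use assms(2) in \<open>auto simp: norm_mult intro: mult_left_le_one_le\<close>)

lemma coord_op_b: "coord (op_b q x) (k, l) = of_real (q ^ k) * coord x (k, l - 1)"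
proof -
  have "square_summable (\<lambda>p. of_real (q ^ fst p) * coord x (fst p, snd p - 1))"
    by (rule square_summable_weighted) (use q in \<open>auto simp: inj_def norm_power power_le_one\<close>)
  then show ?thesis
    unfolding op_b_def by (subst coord_ell2_of) (simp_all add: case_prod_unfold)
qed

lemma coord_op_F: "coord (op_F x) (k, l) = sign0 l * coord x (k, l)"
proof -
  have "square_summable (\<lambda>p. sign0 (snd p) * coord x p)"
    by (rule square_summable_weighted) (auto simp: inj_def sign0_def)
  then show ?thesis
    unfolding op_F_def by (subst coord_ell2_of) (simp_all add: case_prod_unfold)
qed

lemma coord_op_K:
  "x \<in> K_domain q \<Longrightarrow> coord (op_K q x) (k, l) = of_real (q powi (- 2 * int k)) * coord x (k, l)"
  unfolding K_domain_def op_K_def by (simp add: coord_ell2_of)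

lemma ket_in_K_domain: "ket p \<in> K_domain q"
  unfolding K_domain_def mem_Collect_eq
  by (rule square_summable_finite, rule finite_subset[of _ "{p}"]) (auto simp: coord_ket split: if_splits)

lemma op_a_ket: "op_a q (ket (k, l)) = of_real (sqrt (1 - q ^ (2 * k + 2))) *\<^sub>C ket (k + 1, l)"
  by (rule ell2_eqI) (auto simp: coord_op_a coord_ket gr0_conv_Suc split: if_splits)

lemma op_b_ket: "op_b q (ket (k, l)) = of_real (q ^ k) *\<^sub>C ket (k, l + 1)"
  by (rule ell2_eqI) (auto simp: coord_op_b coord_ket split: if_splits)

lemma op_F_ket: "op_F (ket (k, l)) = sign0 l *\<^sub>C ket (k, l)"
  by (rule ell2_eqI) (auto simp: coord_op_F coord_ket split: if_splits)

lemma op_K_ket: "op_K q (ket (k, l)) = of_real (q powi (- 2 * int k)) *\<^sub>C ket (k, l)"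
  by (rule ell2_eqI) (auto simp: coord_op_K[OF ket_in_K_domain] coord_ket split: if_splits)

lemma adjoint_pair_F: "adjoint_pair op_F op_F"
  unfolding adjoint_pair_def cinner_def
  by (auto intro!: infsum_cong simp: coord_op_F sign0_def split_paired_all)

lemma op_F_involutive: "op_F \<circ> op_F = id"
  by (auto intro!: ell2_eqI simp: fun_eq_iff coord_op_F sign0_def)

lemma op_K_commutes_F:
  assumes "x \<in> K_domain q"
  shows "op_F x \<in> K_domain q" and "op_K q (op_F x) = op_F (op_K q x)"
proof -
  have e: "of_real (q powi (- 2 * int k)) * coord (op_F x) (k, l) = coord (op_F (op_K q x)) (k, l)"
    for k l
    by (simp add: coord_op_F coord_op_K[OF assms])
  show dom: "op_F x \<in> K_domain q"
    unfolding K_domain_def mem_Collect_eq e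
    using coord_square_summable[of "op_F (op_K q x)"] by simp
  show "op_K q (op_F x) = op_F (op_K q x)"
  proof (rule ell2_eqI)
    fix p :: "nat \<times> int"
    show "coord (op_K q (op_F x)) p = coord (op_F (op_K q x)) p"
      by (cases p) (simp only: coord_op_K[OF dom] e)
  qed
qed

definition op_a_star :: "hilb \<Rightarrow> hilb" where
  "op_a_star x = ell2_of (\<lambda>(k, l). of_real (sqrt (1 - q ^ (2 * k + 2))) * coord x (k + 1, l))"

definition op_b_star :: "hilb \<Rightarrow> hilb" where
  "op_b_star x = ell2_of (\<lambda>(k, l). of_real (q ^ k) * coord x (k, l + 1))"

lemma coord_op_a_star:
  "coord (op_a_star x) (k, l) = of_real (sqrt (1 - q ^ (2 * k + 2))) * coord x (k + 1, l)"
proof -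
  have "square_summable (\<lambda>p. of_real (sqrt (1 - q ^ (2 * fst p + 2))) * coord x (fst p + 1, snd p))"
  proof (rule square_summable_weighted)
    fix p :: "nat \<times> int"
    have "0 \<le> 1 - q ^ (2 * fst p + 2)" "1 - q ^ (2 * fst p + 2) \<le> 1"
      using q power_le_one[of q "2 * fst p + 2"] by simp_all
    then show "cmod (of_real (sqrt (1 - q ^ (2 * fst p + 2)))) \<le> 1"
      by simp
  qed (auto simp: inj_def)
  then show ?thesis
    unfolding op_a_star_def by (subst coord_ell2_of) (simp_all add: case_prod_unfold)
qed

lemma coord_op_b_star: "coord (op_b_star x) (k, l) = of_real (q ^ k) * coord x (k, l + 1)"
proof -
  have "square_summable (\<lambda>p. of_real (q ^ fst p) * coord x (fst p, snd p + 1))"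
    by (rule square_summable_weighted) (use q in \<open>auto simp: inj_def norm_power power_le_one\<close>)
  then show ?thesis
    unfolding op_b_star_def by (subst coord_ell2_of) (simp_all add: case_prod_unfold)
qed

lemma adjoint_pair_a: "adjoint_pair (op_a q) op_a_star"
  unfolding adjoint_pair_def
proof (intro allI)
  fix x y :: hilb
  have inj: "inj (\<lambda>(k::nat, l::int). (Suc k, l))"
    by (auto simp: inj_def)
  have "cinner (op_a q x) y =
      (\<Sum>\<^sub>\<infinity>p\<in>range (\<lambda>(k, l). (Suc k, l)). cnj (coord (op_a q x) p) * coord y p)"
    unfolding cinner_def
    by (rule infsum_cong_neutral) (auto simp: coord_op_a image_iff gr0_conv_Suc split: if_splits)
  also have "\<dots> = cinner x (op_a_star y)"
    unfolding cinner_def infsum_reindex[OF inj]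
    by (rule infsum_cong) (auto simp: coord_op_a coord_op_a_star)
  finally show "cinner (op_a q x) y = cinner x (op_a_star y)" .
qed

lemma adjoint_pair_b: "adjoint_pair (op_b q) op_b_star"
  unfolding adjoint_pair_def
proof (intro allI)
  fix x y :: hilb
  have bij: "bij (\<lambda>(k::nat, l::int). (k, l + 1))"
    by (rule bij_betw_byWitness[where f' = "\<lambda>(k, l). (k, l - 1)"]) auto
  have "cinner (op_b q x) y = (\<Sum>\<^sub>\<infinity>p. cnj (coord (op_b q x) p) * coord y p)"
    by (simp add: cinner_def)
  also have "\<dots> = cinner x (op_b_star y)"
    unfolding cinner_def
    by (subst infsum_reindex_bij_betw[OF bij, symmetric], rule infsum_cong)
      (auto simp: coord_op_b coord_op_b_star)
  finally show "cinner (op_b q x) y = cinner x (op_b_star y)" .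
qed

lemmas adj_a = adj_eqI[OF adjoint_pair_a]
lemmas adj_b = adj_eqI[OF adjoint_pair_b]

lemma adjoint_pair_id: "adjoint_pair id id" and adjoint_pair_zero: "adjoint_pair (\<lambda>_. 0) (\<lambda>_. 0)"
  by (simp_all add: adjoint_pair_def cinner_def)

lemma adjoint_pair_ops:
  fixes S S' T T' :: "'b ell2 \<Rightarrow> 'b ell2"
  assumes "adjoint_pair S S'" "adjoint_pair T T'"
  shows "adjoint_pair (\<lambda>x. S x + T x) (\<lambda>x. S' x + T' x)"
    "adjoint_pair (S \<circ> T) (T' \<circ> S')"
    "adjoint_pair (\<lambda>x. c *\<^sub>C S x) (\<lambda>x. cnj c *\<^sub>C S' x)"
proof -
  have add_right: "cinner x (y + z) = cinner x y + cinner x z" for x y z :: "'b ell2"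
    using cinner_add_left[of y z x] by (metis cinner_commute complex_cnj_add)
  show "adjoint_pair (\<lambda>x. S x + T x) (\<lambda>x. S' x + T' x)"
    using assms unfolding adjoint_pair_def by (simp add: cinner_add_left add_right)
  show "adjoint_pair (S \<circ> T) (T' \<circ> S')"
    using assms unfolding adjoint_pair_def by simp
  show "adjoint_pair (\<lambda>x. c *\<^sub>C S x) (\<lambda>x. cnj c *\<^sub>C S' x)"
    using assms unfolding adjoint_pair_def
    by (simp add: cinner_scaleC_left cinner_scaleC_right)
qed

lemma adjoint_pair_eval: "adjoint_pair (suq2_eval q t) (adj (suq2_eval q t))"
proof -
  have "\<exists>T. adjoint_pair (suq2_eval q t) T"
  proof (induction t)
    case (Star t)
    then show ?case
      using adj_eqI adjoint_pair_sym by (metis suq2_eval.simps(8))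
  qed (unfold suq2_eval.simps; blast intro: adjoint_pair_a adjoint_pair_b adjoint_pair_id
      adjoint_pair_zero adjoint_pair_ops)+
  then show ?thesis
    using adj_eqI by metis
qed

lemma sqrt_weight:
  "complex_of_real (sqrt (1 - q ^ (2 * k))) * (of_real (sqrt (1 - q ^ (2 * k))) * c)
    = (1 - of_real (q ^ k) * of_real (q ^ k)) * c"
proof -
  have "0 \<le> 1 - q ^ (2 * k)"
    using q by (simp add: power_le_one)
  then have "sqrt (1 - q ^ (2 * k)) * sqrt (1 - q ^ (2 * k)) = 1 - q ^ k * q ^ k"
    by (simp add: mult_2 power_add)
  then show ?thesis
    by (simp only: mult.assoc[symmetric] of_real_mult[symmetric]) simp
qed

lemma coord_a_a_star:
  "coord (op_a q (op_a_star x)) (k, l) = (1 - of_real (q ^ k) * of_real (q ^ k)) * coord x (k, l)"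
proof (cases "k = 0")
  case False
  then have "2 * (k - 1) + 2 = 2 * k" "k - 1 + 1 = k"
    by simp_all
  with False show ?thesis
    by (simp only: coord_op_a coord_op_a_star sqrt_weight if_False)
qed (simp add: coord_op_a)

lemma coord_a_star_a:
  "coord (op_a_star (op_a q x)) (k, l) =
    (1 - of_real (q ^ (k + 1)) * of_real (q ^ (k + 1))) * coord x (k, l)"
proof -
  have "2 * k + 2 = 2 * (k + 1)" "k + 1 - 1 = k" "k + 1 \<noteq> 0"
    by simp_all
  then show ?thesis
    by (simp only: coord_op_a coord_op_a_star sqrt_weight if_False)
qed

lemma suq2_eval_cong: "suq2_eq q s t \<Longrightarrow> suq2_eval q s = suq2_eval q t"
proof (induction rule: suq2_eq.induct)
  case (Star_Star s)
  show ?case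
    unfolding suq2_eval.simps by (rule adj_eqI[OF adjoint_pair_sym[OF adjoint_pair_eval]])
next
  case (Star_Add s t)
  show ?case
    unfolding suq2_eval.simps by (rule adj_eqI[OF adjoint_pair_ops(1)[OF adjoint_pair_eval adjoint_pair_eval]])
next
  case (Star_Mul s t)
  show ?case
    unfolding suq2_eval.simps by (rule adj_eqI[OF adjoint_pair_ops(2)[OF adjoint_pair_eval adjoint_pair_eval]])
next
  case (Star_Scale c s)
  show ?case
    unfolding suq2_eval.simps by (rule adj_eqI[OF adjoint_pair_ops(3)[OF adjoint_pair_eval adjoint_pair_eval]])
next
  case ba
  show ?case
  proof (intro ext ell2_eqI)
    fix x :: hilb and p :: "nat \<times> int"
    obtain k l where p: "p = (k, l)" by fastforce
    show "coord (suq2_eval q (Mul Gen_b Gen_a) x) p =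
        coord (suq2_eval q (Scale (of_real q) (Mul Gen_a Gen_b)) x) p"
      by (cases k) (simp_all add: p coord_op_a coord_op_b )
  qed
next
  case b_normal
  then show ?case
    by (auto intro!: ell2_eqI simp: fun_eq_iff coord_op_b coord_op_b_star adj_b)
next
  case b_star_a
  show ?case
  proof (intro ext ell2_eqI)
    fix x :: hilb and p :: "nat \<times> int"
    obtain k l where p: "p = (k, l)" by fastforce
    show "coord (suq2_eval q (Mul (Star Gen_b) Gen_a) x) p =
        coord (suq2_eval q (Scale (of_real q) (Mul Gen_a (Star Gen_b))) x) p"
      by (cases k) (simp_all add: p coord_op_a coord_op_b coord_op_b_star adj_b)
  qed
next
  case a_a_star
  show ?case
  proof (intro ext ell2_eqI)
    fix x :: hilb and p :: "nat \<times> int"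
    obtain k l where p: "p = (k, l)" by fastforce
    show "coord (suq2_eval q (Add (Mul Gen_a (Star Gen_a)) (Mul Gen_b (Star Gen_b))) x) p =
        coord (suq2_eval q Unit x) p"
      by (simp add: p adj_a adj_b coord_a_a_star coord_op_b coord_op_b_star left_diff_distrib)
  qed
next
  case a_star_a
  show ?case
  proof (intro ext ell2_eqI)
    fix x :: hilb and p :: "nat \<times> int"
    obtain k l where p: "p = (k, l)" by fastforce
    show "coord (suq2_eval q (Add (Mul (Star Gen_a) Gen_a)
            (Scale (of_real (q\<^sup>2)) (Mul Gen_b (Star Gen_b)))) x) p =
        coord (suq2_eval q Unit x) p"
      by (simp add: p adj_a adj_b coord_a_star_a coord_op_b coord_op_b_star power2_eq_square
          algebra_simps)
  qed
next
  case (Mul_Add_right s t u)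
  show ?case
    by (rule ext) (simp add: adjoint_pair_linear[OF adjoint_pair_eval])
next
  case (Mul_Scale_right s c t)
  show ?case
    by (rule ext) (simp add: adjoint_pair_linear[OF adjoint_pair_eval])
next
  case (Star_cong s s')
  then show ?case
    by (simp only: suq2_eval.simps)
next
  case (sym s t)
  then show ?case
    by (simp only: suq2_eval.simps)
next
  case (trans s t u)
  then show ?case
    by (simp only: suq2_eval.simps)
next
  case (Add_cong s s' t t')
  then show ?case
    by (simp only: suq2_eval.simps)
next
  case (Mul_cong s s' t t')
  then show ?case
    by (simp only: suq2_eval.simps)
next
  case (Scale_cong s s' c)
  then show ?case
    by (simp only: suq2_eval.simps)
next
  case Add_assoc
  show ?case
    by (intro ext ell2_eqI) (simp add: algebra_simps)
next
  case Add_commute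
  show ?case
    by (intro ext ell2_eqI) (simp add: algebra_simps)
next
  case Add_Null
  show ?case
    by (intro ext ell2_eqI) (simp add: algebra_simps)
next
  case Add_minus
  show ?case
    by (intro ext ell2_eqI) (simp add: algebra_simps)
next
  case Scale_add_right
  show ?case
    by (intro ext ell2_eqI) (simp add: algebra_simps)
next
  case Scale_add_left
  show ?case
    by (intro ext ell2_eqI) (simp add: algebra_simps)
next
  case Scale_Scale
  show ?case
    by (intro ext ell2_eqI) (simp add: algebra_simps)
next
  case Scale_1
  show ?case
    by (intro ext ell2_eqI) (simp add: algebra_simps)
next
  case Mul_assoc
  show ?case
    by (intro ext ell2_eqI) (simp add: algebra_simps)
next
  case Mul_Unit_left
  show ?case
    by (intro ext ell2_eqI) (simp add: algebra_simps)
next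
  case Mul_Unit_right
  show ?case
    by (intro ext ell2_eqI) (simp add: algebra_simps)
next
  case Mul_Add_left
  show ?case
    by (intro ext ell2_eqI) (simp add: algebra_simps)
next
  case Mul_Scale_left
  show ?case
    by (intro ext ell2_eqI) (simp add: algebra_simps)
qed (rule HOL.refl)

lemma pi0_class: "pi0 q (suq2_class q t) = suq2_eval q t"
proof -
  have "suq2_eval q s = suq2_eval q t" if "s \<in> suq2_class q t" for s
    using that suq2_eval_cong[of t s] by (simp only: mem_suq2_class)
  moreover have "t \<in> suq2_class q t"
    unfolding mem_suq2_class by (rule suq2_eq.refl)
  ultimately have "suq2_eval q ` suq2_class q t = {suq2_eval q t}"
    by (intro equalityI subsetI) blast+
  then show ?thesis
    by (simp only: pi0_def the_elem_eq)
qed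

lemma suq2_Scale_0: "suq2_eq q (Scale 0 s) Null"
proof -
  have "suq2_eq q (Scale (1 + - 1) s) (Add (Scale 1 s) (Scale (- 1) s))"
    by (rule suq2_eq.Scale_add_left)
  moreover have "suq2_eq q (Add (Scale 1 s) (Scale (- 1) s)) (Add s (Scale (- 1) s))"
    by (intro suq2_eq.Add_cong suq2_eq.Scale_1 suq2_eq.refl)
  ultimately show ?thesis
    using suq2_eq.Add_minus[of q s] by (metis add.right_inverse suq2_eq.trans)
qed

lemma suq2_cancel:
  assumes "suq2_eq q s (Scale (- c) w)" "suq2_eq q t (Scale c w)"
  shows "suq2_eq q (Add s t) Null"
proof -
  have "suq2_eq q (Add s t) (Add (Scale (- c) w) (Scale c w))"
    by (rule suq2_eq.Add_cong[OF assms])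
  moreover have "suq2_eq q (Add (Scale (- c) w) (Scale c w)) (Scale (- c + c) w)"
    by (rule suq2_eq.sym[OF suq2_eq.Scale_add_left])
  ultimately show ?thesis
    using suq2_Scale_0[of w] by (metis add.left_inverse suq2_eq.trans)
qed

lemma suq2_Mul_Scales: "suq2_eq q (Mul (Scale c s) (Scale d t)) (Scale (c * d) (Mul s t))"
  by (meson suq2_eq.Mul_Scale_left suq2_eq.Mul_Scale_right suq2_eq.Scale_Scale
      suq2_eq.Scale_cong suq2_eq.trans)

lemma suq2_a_star_b_star:
  "suq2_eq q (Mul (Star Gen_a) (Star Gen_b)) (Scale (of_real q) (Mul (Star Gen_b) (Star Gen_a)))"
proof -
  have "suq2_eq q (Star (Mul Gen_b Gen_a)) (Star (Scale (of_real q) (Mul Gen_a Gen_b)))"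
    by (rule suq2_eq.Star_cong[OF suq2_eq.ba])
  moreover have "suq2_eq q (Star (Scale (of_real q) (Mul Gen_a Gen_b)))
      (Scale (of_real q) (Star (Mul Gen_a Gen_b)))"
    using suq2_eq.Star_Scale[of q "of_real q"] by simp
  moreover have "suq2_eq q (Scale (of_real q) (Star (Mul Gen_a Gen_b)))
      (Scale (of_real q) (Mul (Star Gen_b) (Star Gen_a)))"
    by (intro suq2_eq.Scale_cong suq2_eq.Star_Mul)
  ultimately show ?thesis
    by (meson suq2_eq.Star_Mul suq2_eq.sym suq2_eq.trans)
qed

lemma suq2_a_star_b:
  "suq2_eq q (Mul (Star Gen_a) Gen_b) (Scale (of_real q) (Mul Gen_b (Star Gen_a)))"
proof -
  have "suq2_eq q (Star (Mul (Star Gen_b) Gen_a))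
      (Star (Scale (of_real q) (Mul Gen_a (Star Gen_b))))"
    by (rule suq2_eq.Star_cong[OF suq2_eq.b_star_a])
  moreover have "suq2_eq q (Star (Scale (of_real q) (Mul Gen_a (Star Gen_b))))
      (Scale (of_real q) (Star (Mul Gen_a (Star Gen_b))))"
    using suq2_eq.Star_Scale[of q "of_real q"] by simp
  moreover have "suq2_eq q (Star (Mul Gen_a (Star Gen_b))) (Mul Gen_b (Star Gen_a))"
    by (rule suq2_eq.trans[OF suq2_eq.Star_Mul])
      (intro suq2_eq.Mul_cong suq2_eq.Star_Star suq2_eq.refl)
  moreover have "suq2_eq q (Star (Mul (Star Gen_b) Gen_a)) (Mul (Star Gen_a) Gen_b)"
    by (rule suq2_eq.trans[OF suq2_eq.Star_Mul])
      (intro suq2_eq.Mul_cong suq2_eq.Star_Star suq2_eq.refl)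
  ultimately show ?thesis
    by (meson suq2_eq.Scale_cong suq2_eq.sym suq2_eq.trans)
qed

lemma suq2_V_class:
  "suq2_V q $ 1 $ 1 = suq2_class q (Scale (- of_real q) (Star Gen_b))"
  "suq2_V q $ 1 $ 2 = suq2_class q (Star Gen_a)"
  "suq2_V q $ 2 $ 1 = suq2_class q Gen_a"
  "suq2_V q $ 2 $ 2 = suq2_class q Gen_b"
  by (simp_all add: suq2_V_def suq2_a_def suq2_b_def suq2_ops_class)

lemma M2_star_V_class:
  "M2_star q (suq2_V q) $ 1 $ 1 = suq2_class q (Scale (- of_real q) Gen_b)"
  "M2_star q (suq2_V q) $ 1 $ 2 = suq2_class q (Star Gen_a)"
  "M2_star q (suq2_V q) $ 2 $ 1 = suq2_class q Gen_a"
  "M2_star q (suq2_V q) $ 2 $ 2 = suq2_class q (Star Gen_b)"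
proof -
  have "suq2_eq q (Star (Scale (- of_real q) (Star Gen_b)))
      (Scale (- of_real q) (Star (Star Gen_b)))"
    using suq2_eq.Star_Scale[of q "- of_real q"] by simp
  then have "suq2_eq q (Star (Scale (- of_real q) (Star Gen_b))) (Scale (- of_real q) Gen_b)"
    by (meson suq2_eq.Scale_cong suq2_eq.Star_Star suq2_eq.trans)
  then show "M2_star q (suq2_V q) $ 1 $ 1 = suq2_class q (Scale (- of_real q) Gen_b)"
    by (simp add: M2_star_def suq2_V_class suq2_ops_class suq2_class_eqI)
  show "M2_star q (suq2_V q) $ 2 $ 1 = suq2_class q Gen_a"
    by (simp add: M2_star_def suq2_V_class suq2_ops_class suq2_class_eqI[OF suq2_eq.Star_Star])
qed (simp_all add: M2_star_def suq2_V_class suq2_ops_class)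

lemma suq2_V_in: "suq2_V q $ i $ j \<in> suq2 q"
  using exhaust_2[of i] exhaust_2[of j] suq2_V_class suq2_class_in by metis

lemma suq2_V_unitary:
  "M2_mult q (suq2_V q) (M2_star q (suq2_V q)) = M2_one q"
  "M2_mult q (M2_star q (suq2_V q)) (suq2_V q) = M2_one q"
proof -
  let ?a = Gen_a and ?b = Gen_b and ?q = "complex_of_real q"
  let ?as = "Star Gen_a" and ?bs = "Star Gen_b"
  note e = suq2_eq.trans[OF suq2_eq.Add_commute]
  have sq: "suq2_eq q (Mul (Scale (- ?q) s) (Scale (- ?q) t)) (Scale (of_real (q\<^sup>2)) (Mul s t))" for s t
    using suq2_Mul_Scales[of "- ?q" s "- ?q" t] by (simp add: power2_eq_square)
  have sq': "suq2_eq q (Mul (Scale (- ?q) ?bs) (Scale (- ?q) ?b)) (Scale (of_real (q\<^sup>2)) (Mul ?b ?bs))"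
    by (meson sq suq2_eq.Scale_cong suq2_eq.b_normal suq2_eq.sym suq2_eq.trans)
  have 1: "suq2_eq q (Add (Mul (Scale (- ?q) ?bs) (Scale (- ?q) ?b)) (Mul ?as ?a)) Unit"
    by (rule e, rule suq2_eq.trans[OF suq2_eq.Add_cong[OF suq2_eq.refl sq'] suq2_eq.a_star_a])
  have 2: "suq2_eq q (Add (Mul (Scale (- ?q) ?bs) ?as) (Mul ?as ?bs)) Null"
    by (rule suq2_cancel[OF suq2_eq.Mul_Scale_left suq2_a_star_b_star])
  have 3: "suq2_eq q (Add (Mul ?a (Scale (- ?q) ?b)) (Mul ?b ?a)) Null"
    by (rule suq2_cancel[OF suq2_eq.Mul_Scale_right suq2_eq.ba])
  have 4: "suq2_eq q (Add (Mul ?a ?as) (Mul ?b ?bs)) Unit"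
    by (rule suq2_eq.a_a_star)
  have 5: "suq2_eq q (Add (Mul (Scale (- ?q) ?b) (Scale (- ?q) ?bs)) (Mul ?as ?a)) Unit"
    by (rule e, rule suq2_eq.trans[OF suq2_eq.Add_cong[OF suq2_eq.refl sq] suq2_eq.a_star_a])
  have 6: "suq2_eq q (Add (Mul (Scale (- ?q) ?b) ?as) (Mul ?as ?b)) Null"
    by (rule suq2_cancel[OF suq2_eq.Mul_Scale_left suq2_a_star_b])
  have 7: "suq2_eq q (Add (Mul ?a (Scale (- ?q) ?bs)) (Mul ?bs ?a)) Null"
    by (rule suq2_cancel[OF suq2_eq.Mul_Scale_right suq2_eq.b_star_a])
  have 8: "suq2_eq q (Add (Mul ?a ?as) (Mul ?bs ?b)) Unit"
    by (meson suq2_eq.Add_cong suq2_eq.a_a_star suq2_eq.b_normal suq2_eq.refl suq2_eq.sym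
        suq2_eq.trans)
  show "M2_mult q (suq2_V q) (M2_star q (suq2_V q)) = M2_one q"
    using 1 2 3 4
    by (simp add: vec_eq_iff forall_2 M2_mult_def M2_one_def suq2_V_class M2_star_V_class
        suq2_ops_class suq2_one_def suq2_zero_def suq2_class_eqI)
  show "M2_mult q (M2_star q (suq2_V q)) (suq2_V q) = M2_one q"
    using 5 6 7 8
    by (simp add: vec_eq_iff forall_2 M2_mult_def M2_one_def suq2_V_class M2_star_V_class
        suq2_ops_class suq2_one_def suq2_zero_def suq2_class_eqI)
qed

lemma component_arith:
  "component r (x + y) = component r x + component r y"
  "component r (x - y) = component r x - component r y"
  by (auto intro!: ell2_eqI simp: coord_component)

lemma component_op_F2: "component r (op_F2 x) = op_F (component r x)"
  using exhaust_2[of r]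
  by (auto intro!: ell2_eqI simp: op_F2_def tensor_op_def component_matrix_op sum_2 mat_def)

lemma component_op_K2:
  "component 1 (op_K2 q x) = of_real (inverse q) *\<^sub>C op_K q (component 1 x)"
  "component 2 (op_K2 q x) = of_real q *\<^sub>C op_K q (component 2 x)"
  by (auto intro!: ell2_eqI simp: op_K2_def tensor_op_def component_matrix_op sum_2)

lemma component_M2_pi0:
  "component r (M2_pi0 q M x) =
    pi0 q (M $ r $ 1) (component 1 x) + pi0 q (M $ r $ 2) (component 2 x)"
  by (simp add: M2_pi0_def component_matrix_op sum_2)

lemma component_V:
  "component 1 (M2_pi0 q (suq2_V q) x) =
    - of_real q *\<^sub>C op_b_star (component 1 x) + op_a_star (component 2 x)"
  "component 2 (M2_pi0 q (suq2_V q) x) = op_a q (component 1 x) + op_b q (component 2 x)"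
  by (simp_all add: component_M2_pi0 suq2_V_class pi0_class adj_a adj_b)

lemma component_V_star:
  "component 1 (M2_pi0 q (M2_star q (suq2_V q)) x) =
    - of_real q *\<^sub>C op_b q (component 1 x) + op_a_star (component 2 x)"
  "component 2 (M2_pi0 q (M2_star q (suq2_V q)) x) = op_a q (component 1 x) + op_b_star (component 2 x)"
  by (simp_all add: component_M2_pi0 M2_star_V_class pi0_class adj_a adj_b)

lemma coord_hilb2: "coord x ((k, l), r) = coord (component r x) (k, l)" for x :: hilb2
  by (simp add: coord_component)

lemma coord_commutator_V:
  "coord (commutator op_F2 (M2_pi0 q (suq2_V q)) x) ((k, l), 1) =
    (if l = - 1 then 2 * of_real (q ^ (k + 1)) * coord x ((k, 0), 1) else 0)"
  "coord (commutator op_F2 (M2_pi0 q (suq2_V q)) x) ((k, l), 2) =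
    (if l = 0 then 2 * of_real (q ^ k) * coord x ((k, - 1), 2) else 0)"
  by (auto simp: commutator_def component_arith component_op_F2 component_V coord_op_F coord_op_a
      coord_op_b coord_op_a_star coord_op_b_star coord_hilb2 sign0_def algebra_simps)

lemma coord_commutator_V_star:
  "coord (commutator op_F2 (M2_pi0 q (M2_star q (suq2_V q))) x) ((k, l), 1) =
    (if l = 0 then - 2 * of_real (q ^ (k + 1)) * coord x ((k, - 1), 1) else 0)"
  "coord (commutator op_F2 (M2_pi0 q (M2_star q (suq2_V q))) x) ((k, l), 2) =
    (if l = - 1 then - 2 * of_real (q ^ k) * coord x ((k, 0), 2) else 0)"
  by (auto simp: commutator_def component_arith component_op_F2 component_V_star coord_op_F coord_op_a
      coord_op_b coord_op_a_star coord_op_b_star coord_hilb2 sign0_def algebra_simps)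

lemma coord_op_F2: "coord (op_F2 x) ((k, l), r) = sign0 l * coord x ((k, l), r)"
  by (simp add: coord_hilb2 component_op_F2 coord_op_F)

lemma coord_chern3_op:
  "coord (chern3_op q (suq2_V q) x) ((k, l), 1) =
    (if l = - 1 then - 16 * of_real (q ^ (4 * k + 4)) * coord x ((k, - 1), 1) else 0)"
  "coord (chern3_op q (suq2_V q) x) ((k, l), 2) =
    (if l = 0 then 16 * of_real (q ^ (4 * k)) * coord x ((k, 0), 2) else 0)"
proof -
  have 1: "q ^ (4 * k + 4) = q ^ (k + 1) * (q ^ (k + 1) * (q ^ (k + 1) * q ^ (k + 1)))"
    and 2: "q ^ (4 * k) = q ^ k * (q ^ k * (q ^ k * q ^ k))"
    unfolding power_add[symmetric] by (rule arg_cong[where f = "\<lambda>n. q ^ n"], simp)+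
  show "coord (chern3_op q (suq2_V q) x) ((k, l), 1) =
    (if l = - 1 then - 16 * of_real (q ^ (4 * k + 4)) * coord x ((k, - 1), 1) else 0)"
    unfolding 1 by (simp add: chern3_op_def coord_op_F2 coord_commutator_V coord_commutator_V_star
        sign0_def)
  show "coord (chern3_op q (suq2_V q) x) ((k, l), 2) =
    (if l = 0 then 16 * of_real (q ^ (4 * k)) * coord x ((k, 0), 2) else 0)"
    unfolding 2 by (simp add: chern3_op_def coord_op_F2 coord_commutator_V coord_commutator_V_star
        sign0_def)
qed

lemma chern3_op_in_domain: "chern3_op q (suq2_V q) x \<in> K2_domain q"
  unfolding K2_domain_def K_domain_def mem_Collect_eq
proof
  fix r :: 2
  have w: "q powi (- 2 * int k) * q ^ (4 * k + m) \<le> 1" for k m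
  proof -
    have "q powi (- 2 * int k) * q ^ (4 * k + m) = q powi (- 2 * int k + int (4 * k + m))"
      using q by (simp only: power_int_add[OF disjI1[OF less_imp_neq[THEN not_sym]]] power_int_of_nat)
    also have "- 2 * int k + int (4 * k + m) = int (2 * k + m)"
      by simp
    finally show ?thesis
      using q by (simp only: power_int_of_nat) (simp add: power_le_one)
  qed
  have bound: "cmod (of_real (q powi (- 2 * int k)) *
      coord (component r (chern3_op q (suq2_V q) x)) (k, l)) \<le>
      16 * cmod (coord (component r x) (k, l))" for k l
  proof -
    consider "coord (component r (chern3_op q (suq2_V q) x)) (k, l) = 0"
      | m where "cmod (coord (component r (chern3_op q (suq2_V q) x)) (k, l)) =
          16 * q ^ (4 * k + m) * cmod (coord (component r x) (k, l))"
    proof -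
      have "coord (component r (chern3_op q (suq2_V q) x)) (k, l) = 0 \<or>
        cmod (coord (component r (chern3_op q (suq2_V q) x)) (k, l)) =
          16 * q ^ (4 * k + 4) * cmod (coord (component r x) (k, l)) \<or>
        cmod (coord (component r (chern3_op q (suq2_V q) x)) (k, l)) =
          16 * q ^ (4 * k + 0) * cmod (coord (component r x) (k, l))"
        using exhaust_2[of r] q
        by (auto simp: coord_component coord_chern3_op norm_mult norm_power simp del: of_real_power)
      then show ?thesis
        using that by blast
    qed
    then show ?thesis
    proof cases
      case (2 m)
      have "0 \<le> q powi (- 2 * int k)"
        using q by simp
      then have "cmod (of_real (q powi (- 2 * int k)) *
          coord (component r (chern3_op q (suq2_V q) x)) (k, l)) =
          (q powi (- 2 * int k) * q ^ (4 * k + m)) * (16 * cmod (coord (component r x) (k, l)))"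
        unfolding norm_mult 2 by (simp only: norm_of_real abs_of_nonneg mult_ac)
      also have "\<dots> \<le> 1 * (16 * cmod (coord (component r x) (k, l)))"
        by (intro mult_right_mono w) simp
      finally show ?thesis
        by simp
    qed simp
  qed
  show "square_summable (\<lambda>(k, l). of_real (q powi (- 2 * int k)) *
      coord (component r (chern3_op q (suq2_V q) x)) (k, l))"
    by (rule square_summable_mono[OF coord_square_summable[of "component r x"], where C = 16])
      (use bound in \<open>simp only: split_paired_all prod.case\<close>)
qed

lemma op_K2_commutes_V:
  assumes "x \<in> K2_domain q"
  shows "M2_pi0 q (suq2_V q) x \<in> K2_domain q"
    and "op_K2 q (M2_pi0 q (suq2_V q) x) = M2_pi0 q (suq2_V q) (op_K2 q x)"
proof -
  let ?V = "M2_pi0 q (suq2_V q)"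
  have dom: "component r x \<in> K_domain q" for r
    using assms by (simp add: K2_domain_def)
  define P where "P k = complex_of_real (q powi (- 2 * int k))" for k
  have P_Suc: "P (k + 1) = P k / (of_real q * of_real q)" for k
  proof -
    have "- 2 * int k = - 2 * int (k + 1) + 2"
      by simp
    then have "q powi (- 2 * int k) = q powi (- 2 * int (k + 1)) * q powi 2"
      using q by (simp only: power_int_add[OF disjI1[OF less_imp_neq[THEN not_sym]]])
    then show ?thesis
      using q by (simp add: P_def power2_eq_square field_simps)
  qed
  have P_K: "coord (op_K q (component r x)) (k, l) = P k * coord (component r x) (k, l)" for r k l
    by (simp add: coord_op_K[OF dom] P_def)
  have c1: "coord (component 1 (?V (op_K2 q x))) (k, l) =
      of_real (inverse q) * (P k * coord (component 1 (?V x)) (k, l))" for k l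
    using q by (simp add: component_V component_op_K2 coord_op_b_star coord_op_a_star P_K
        P_Suc[unfolded Suc_eq_plus1[symmetric]] field_simps)
  have c2: "coord (component 2 (?V (op_K2 q x))) (k, l) =
      of_real q * (P k * coord (component 2 (?V x)) (k, l))" for k l
    using q by (cases k) (simp_all add: component_V component_op_K2 coord_op_b coord_op_a P_K
        P_Suc[unfolded Suc_eq_plus1[symmetric]] field_simps)
  have "square_summable (\<lambda>p. of_real q * coord (component 1 (?V (op_K2 q x))) p)"
    "square_summable (\<lambda>p. of_real (inverse q) * coord (component 2 (?V (op_K2 q x))) p)"
    by (intro square_summable_scale coord_square_summable)+
  moreover have "(\<lambda>p. of_real q * coord (component 1 (?V (op_K2 q x))) p) =
      (\<lambda>(k, l). of_real (q powi (- 2 * int k)) * coord (component 1 (?V x)) (k, l))"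
    "(\<lambda>p. of_real (inverse q) * coord (component 2 (?V (op_K2 q x))) p) =
      (\<lambda>(k, l). of_real (q powi (- 2 * int k)) * coord (component 2 (?V x)) (k, l))"
    using q by (auto simp: fun_eq_iff c1 c2 P_def)
  ultimately show dom': "?V x \<in> K2_domain q"
    unfolding K2_domain_def K_domain_def mem_Collect_eq forall_2 by simp
  have "component r (op_K2 q (?V x)) = component r (?V (op_K2 q x))" for r
    using exhaust_2[of r] dom'
    by (auto intro!: ell2_eqI simp: component_op_K2 K2_domain_def coord_op_K c1 c2 P_def)
  then show "op_K2 q (?V x) = ?V (op_K2 q x)"
    by (rule ell2_component_eqI)
qed

end

end

theory Submission
  imports Defs
begin

text \<open>The commutators of \<open>F\<close> with \<open>V\<close> and \<open>V\<^sup>*\<close> only see the entries \<open>b\<close>, \<open>b\<^sup>*\<close>, since \<open>F\<close> commutes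
  with \<open>a\<close>; the operator under the trace is therefore diagonal, supported on the vectors
  \<open>e\<^sub>k\<^sub>,\<^sub>-\<^sub>1 \<otimes> e\<^sub>1\<close> and \<open>e\<^sub>k\<^sub>,\<^sub>0 \<otimes> e\<^sub>2\<close>, with eigenvalues \<open>-16 q\<^sup>2\<^sup>k\<^sup>+\<^sup>3\<close> and \<open>16 q\<^sup>2\<^sup>k\<^sup>+\<^sup>1\<close>. Summing the two geometric
  series gives \<open>16 q (1 - q\<^sup>2) / (1 - q\<^sup>2) = 16 q\<close>.\<close>

definition diag_op :: "('i \<Rightarrow> complex) \<Rightarrow> 'i ell2 \<Rightarrow> 'i ell2" where
  "diag_op w x = ell2_of (\<lambda>i. w i * coord x i)"

lemma norm_ell2_le:
  fixes x :: "'i ell2" and y :: "'j ell2"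
  assumes "(\<Sum>\<^sub>\<infinity>i. (cmod (coord x i))\<^sup>2) \<le> C\<^sup>2 * (\<Sum>\<^sub>\<infinity>i. (cmod (coord y i))\<^sup>2)" "0 \<le> C"
  shows "norm x \<le> C * norm y"
  using real_sqrt_le_mono[OF assms(1)] assms(2)
  by (simp add: norm_ell2_def inner_ell2_def cinner_self real_sqrt_mult)

context
  fixes w :: "'i \<Rightarrow> complex" and C :: real
  assumes w_le: "\<And>i. cmod (w i) \<le> C"
begin

text \<open>A bounded weight keeps \<open>w i * coord x i\<close> square-summable, so the default
  value 0 of \<open>ell2_of\<close> never occurs in \<open>diag_op w x\<close>.\<close>

lemma coord_diag_op: "coord (diag_op w x) i = w i * coord x i"
proof -
  have "square_summable (\<lambda>i. w i * coord x i)"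
    by (rule square_summable_mono[OF coord_square_summable[of x], where C = C])
      (simp add: norm_mult mult_right_mono w_le)
  then show ?thesis
    by (simp add: diag_op_def coord_ell2_of)
qed

lemma bounded_clinear_diag_op: "bounded_clinear (diag_op w)"
proof -
  have C: "0 \<le> C"
    using w_le norm_ge_zero order_trans by blast
  have sq: "(\<lambda>i. (cmod (coord x i))\<^sup>2) summable_on UNIV" for x :: "'i ell2"
    using coord_square_summable[of x] by (simp add: square_summable_def)
  have "norm (diag_op w x) \<le> C * norm x" for x
  proof (rule norm_ell2_le[OF _ C])
    have "(\<Sum>\<^sub>\<infinity>i. (cmod (coord (diag_op w x) i))\<^sup>2) \<le> (\<Sum>\<^sub>\<infinity>i. C\<^sup>2 * (cmod (coord x i))\<^sup>2)"
    proof (rule infsum_mono[OF sq summable_on_cmult_right[OF sq]])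
      show "(cmod (coord (diag_op w x) i))\<^sup>2 \<le> C\<^sup>2 * (cmod (coord x i))\<^sup>2" for i
        using w_le[of i]
        by (simp add: coord_diag_op norm_mult power_mult_distrib mult_right_mono power_mono)
    qed
    then show "(\<Sum>\<^sub>\<infinity>i. (cmod (coord (diag_op w x) i))\<^sup>2) \<le> C\<^sup>2 * (\<Sum>\<^sub>\<infinity>i. (cmod (coord x i))\<^sup>2)"
      by (simp add: infsum_cmult_right')
  qed
  then have "bounded_linear (diag_op w)"
    by (intro bounded_linear_intro[where K = C])
      (auto intro!: ell2_eqI simp: coord_diag_op algebra_simps)
  then show ?thesis
    unfolding bounded_clinear_def by (auto intro!: ell2_eqI simp: coord_diag_op)
qed

lemma cinner_ket_diag_op: "cinner (ket i) (diag_op w (ket i)) = w i"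
  by (simp add: cinner_ket coord_diag_op coord_ket)

end

lemma adj_diag_op:
  assumes "\<And>i. cmod (w i) \<le> C"
  shows "adj (diag_op w) = diag_op (\<lambda>i. cnj (w i))"
proof (rule adj_eqI)
  have "coord (diag_op (\<lambda>i. cnj (w i)) x) i = cnj (w i) * coord x i" for x i
    by (rule coord_diag_op[where C = C]) (simp add: assms)
  then show "adjoint_pair (diag_op w) (diag_op (\<lambda>i. cnj (w i)))"
    by (simp add: adjoint_pair_def cinner_def coord_diag_op[OF assms] mult_ac)
qed

text \<open>The quadratic form is the series of \<open>r i * (cmod (coord x i))\<^sup>2\<close>,
  whose terms are real and nonnegative.\<close>

lemma positive_diag_op:
  assumes "\<And>i. cmod (w i) \<le> C" "\<And>i. w i = of_real (r i)" "\<And>i. 0 \<le> r i"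
  shows "positive_op (diag_op w)"
proof -
  have "cinner x (diag_op w x) = of_real (\<Sum>\<^sub>\<infinity>i. r i * (cmod (coord x i))\<^sup>2)" for x
  proof -
    have eq: "(\<lambda>i. cnj (coord x i) * coord (diag_op w x) i) = (\<lambda>i. of_real (r i * (cmod (coord x i))\<^sup>2))"
      by (simp only: coord_diag_op[OF assms(1)] assms(2) of_real_mult complex_norm_square mult_ac)
    \<comment> \<open>This series is the real part of the inner product series, which always
      converges.\<close>
    have "(\<lambda>i. r i * (cmod (coord x i))\<^sup>2) summable_on UNIV"
      using summable_on_Re[OF cinner_summable[of x "diag_op w x"]]
      by (simp only: fun_cong[OF eq] Re_complex_of_real)
    from has_sum_of_real[OF has_sum_infsum[OF this]] show ?thesis
      unfolding cinner_def eq by (rule infsumI)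
  qed
  then show ?thesis
    using bounded_clinear_diag_op[OF assms(1)]
    by (simp add: positive_op_def infsum_nonneg assms(3))
qed

text \<open>The absolute value of \<open>diag_op w\<close> is the diagonal operator with weight
  \<open>cmod (w i)\<close>. Its diagonal is summable because summable complex families are
  absolutely summable, so \<open>op_trace\<close> does not take its default value 0.\<close>

lemma op_trace_diag_op:
  assumes "w summable_on UNIV"
  shows "op_trace (diag_op w) = infsum w UNIV"
proof -
  \<comment> \<open>The total of the absolute values dominates each single one and so serves as the
    uniform bound on \<open>w\<close>.\<close>
  define C where "C = (\<Sum>\<^sub>\<infinity>i. cmod (w i))"
  define v where "v i = complex_of_real (cmod (w i))" for i
  have abs: "(\<lambda>i. cmod (w i)) summable_on UNIV"
    using assms by (simp add: summable_on_iff_abs_summable_on_complex)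
  have w_le: "cmod (w i) \<le> C" for i
    using finite_sum_le_infsum[OF abs, of "{i}"] by (simp add: C_def)
  then have cw_le: "cmod (cnj (w i)) \<le> C" and v_le: "cmod (v i) \<le> C" for i
    by (simp_all add: v_def)
  have "diag_op v \<circ> diag_op v = adj (diag_op w) \<circ> diag_op w"
  proof (intro ext ell2_eqI)
    fix x i
    have "v i * v i = cnj (w i) * w i"
      using complex_norm_square[of "w i"] by (simp add: v_def power2_eq_square mult.commute)
    then show "coord ((diag_op v \<circ> diag_op v) x) i = coord ((adj (diag_op w) \<circ> diag_op w) x) i"
      by (simp add: adj_diag_op[OF w_le] coord_diag_op[OF cw_le] coord_diag_op[OF v_le]
          coord_diag_op[OF w_le] flip: mult.assoc)
  qed
  moreover have "(\<lambda>i. cinner (ket i) (diag_op v (ket i))) summable_on UNIV"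
    using abs by (simp add: cinner_ket_diag_op[OF v_le] v_def summable_on_of_real)
  ultimately have "trace_class (diag_op w)"
    unfolding trace_class_def
    using bounded_clinear_diag_op[of w, OF w_le] positive_diag_op[of v, OF v_le v_def] by auto
  then show ?thesis
    by (simp add: op_trace_def cinner_ket_diag_op[OF w_le])
qed

text \<open>Powers of \<open>q\<^sup>2\<close> are kept explicit so that both families of
  eigenvalues are visibly geometric in \<open>k\<close>.\<close>

fun chern3_weight :: "real \<Rightarrow> (nat \<times> int) \<times> 2 \<Rightarrow> complex" where
  "chern3_weight q ((k, l), r) =
    (if r = 1 \<and> l = - 1 then - 16 * of_real (q ^ 3 * (q\<^sup>2) ^ k)
     else if r = 2 \<and> l = 0 then 16 * of_real (q * (q\<^sup>2) ^ k) else 0)"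

text \<open>Besides the value of the trace, this gives the summability behind the trace class
  property and the boundedness of the weight.\<close>

lemma has_sum_chern3_weight:
  assumes q: "0 < q" "q < 1"
  shows "(chern3_weight q has_sum 16 * of_real q) UNIV"
proof -
  let ?A = "range (\<lambda>k::nat. ((k, - 1 :: int), 1 :: 2))" and ?B = "range (\<lambda>k::nat. ((k, 0 :: int), 2 :: 2))"
  define g where "g = 1 / (1 - q\<^sup>2)"
  have q2: "q\<^sup>2 < 1"
    using q by (simp add: power_less_one_iff)
  have "((\<lambda>k. (q\<^sup>2) ^ k) has_sum g) UNIV"
    unfolding g_def using q2 by (intro sums_nonneg_imp_has_sum geometric_sums) auto
  then have geo: "((\<lambda>k. c * of_real (d * (q\<^sup>2) ^ k)) has_sum c * of_real (d * g)) UNIV"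
    for c :: complex and d
    by (intro has_sum_cmult_right has_sum_of_real)
  have "(chern3_weight q has_sum - 16 * of_real (q ^ 3 * g)) ?A"
    by (subst has_sum_reindex) (use geo[of "- 16" "q ^ 3"] in \<open>auto simp: inj_def o_def\<close>)
  moreover have "(chern3_weight q has_sum 16 * of_real (q * g)) ?B"
    by (subst has_sum_reindex) (use geo[of 16 q] in \<open>auto simp: inj_def o_def\<close>)
  ultimately have "(chern3_weight q has_sum - 16 * of_real (q ^ 3 * g) + 16 * of_real (q * g)) (?A \<union> ?B)"
    by (rule has_sum_Un_disjoint) auto
  moreover have "- 16 * of_real (q ^ 3 * g) + 16 * of_real (q * g) = (16 * of_real q :: complex)"
  proof -
    have "- 16 * (q ^ 3 * g) + 16 * (q * g) = 16 * q * ((1 - q\<^sup>2) * g)"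
      by (simp add: algebra_simps power2_eq_square power3_eq_cube)
    also have "(1 - q\<^sup>2) * g = 1"
      using q2 by (simp add: g_def)
    finally have "- 16 * (q ^ 3 * g) + 16 * (q * g) = 16 * q"
      by simp
    from arg_cong[OF this, of complex_of_real] show ?thesis
      by simp
  qed
  ultimately have "(chern3_weight q has_sum 16 * of_real q) (?A \<union> ?B)"
    by simp
  \<comment> \<open>The weight vanishes off the two lines \<open>?A\<close> and
    \<open>?B\<close>.\<close>
  then show ?thesis
    by (subst has_sum_cong_neutral[where T = "?A \<union> ?B"]) (auto split: if_splits)
qed

text \<open>The decay \<open>q ^ (4 * k)\<close> of the commutator product beats the growth
  \<open>q powi (- 2 * int k)\<close> of the modular operator, so the composition is a bounded
  diagonal operator.\<close>

lemma op_K2_chern3_op: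
  assumes q: "0 < q" "q < 1"
  shows "op_K2 q \<circ> chern3_op q (suq2_V q) = diag_op (chern3_weight q)"
proof (rule ext)
  fix x
  have "(\<lambda>p. cmod (chern3_weight q p)) summable_on UNIV"
    using has_sum_chern3_weight[OF q] has_sum_imp_summable
    by (metis summable_on_iff_abs_summable_on_complex)
  then have bound: "cmod (chern3_weight q p) \<le> (\<Sum>\<^sub>\<infinity>p. cmod (chern3_weight q p))" for p
    using finite_sum_le_infsum[of "\<lambda>p. cmod (chern3_weight q p)" UNIV "{p}"] by simp
  \<comment> \<open>The coordinate formula for \<open>op_K\<close> holds only on
    \<open>K_domain q\<close>, which contains both components of the range of
    \<open>chern3_op\<close>.\<close>
  have K: "coord (op_K q (component r (chern3_op q (suq2_V q) x))) (k, l) =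
      of_real (q powi (- 2 * int k)) * coord (chern3_op q (suq2_V q) x) ((k, l), r)" for k l r
    using chern3_op_in_domain[OF q, of x]
    by (simp add: K2_domain_def coord_op_K[OF q] coord_component)
  have pw: "q powi (- 2 * int k) = inverse ((q\<^sup>2) ^ k)" for k
    by (simp add: power_int_minus power_int_mult flip: power_mult)
  have K2: "coord (op_K2 q (chern3_op q (suq2_V q) x)) ((k, l), 1) =
      of_real (inverse q) * (of_real (inverse ((q\<^sup>2) ^ k)) *
        coord (chern3_op q (suq2_V q) x) ((k, l), 1))"
    "coord (op_K2 q (chern3_op q (suq2_V q) x)) ((k, l), 2) =
      of_real q * (of_real (inverse ((q\<^sup>2) ^ k)) *
        coord (chern3_op q (suq2_V q) x) ((k, l), 2))" for k l
    by (simp_all only: coord_hilb2[OF q, of "op_K2 q _"] component_op_K2[OF q] coord_scaleC K pw)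
  \<comment> \<open>Counting exponents: -1 - 2k + (4k + 4) = 2k + 3 and 1 - 2k + 4k = 2k +
    1.\<close>
  have w1: "inverse q * (inverse ((q\<^sup>2) ^ k) * q ^ (4 * k + 4)) = q ^ 3 * (q\<^sup>2) ^ k"
    and w2: "q * (inverse ((q\<^sup>2) ^ k) * q ^ (4 * k)) = q * (q\<^sup>2) ^ k" for k
  proof -
    have "q ^ (4 * k) = (q\<^sup>2) ^ k * (q\<^sup>2) ^ k"
      by (simp flip: power_mult power_add)
    then show "inverse q * (inverse ((q\<^sup>2) ^ k) * q ^ (4 * k + 4)) = q ^ 3 * (q\<^sup>2) ^ k"
      "q * (inverse ((q\<^sup>2) ^ k) * q ^ (4 * k)) = q * (q\<^sup>2) ^ k"
      using q by (simp_all add: power_add field_simps power3_eq_cube power4_eq_xxxx)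
  qed
  show "(op_K2 q \<circ> chern3_op q (suq2_V q)) x = diag_op (chern3_weight q) x"
  proof (rule ell2_eqI)
    fix p :: "(nat \<times> int) \<times> 2"
    obtain k l r where p: "p = ((k, l), r)"
      by (metis surj_pair)
    show "coord ((op_K2 q \<circ> chern3_op q (suq2_V q)) x) p = coord (diag_op (chern3_weight q) x) p"
    proof (cases "r = 1")
      case True
      have "coord (op_K2 q (chern3_op q (suq2_V q) x)) ((k, l), 1) =
          (if l = - 1 then - 16 * of_real (inverse q * (inverse ((q\<^sup>2) ^ k) * q ^ (4 * k + 4)))
            * coord x ((k, - 1), 1) else 0)"
        by (simp add: K2 coord_chern3_op[OF q])
      then show ?thesis
        unfolding w1 by (simp add: p True coord_diag_op[OF bound])
    next
      case False
      then have r: "r = 2"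
        using exhaust_2 by metis
      have "coord (op_K2 q (chern3_op q (suq2_V q) x)) ((k, l), 2) =
          (if l = 0 then 16 * of_real (q * (inverse ((q\<^sup>2) ^ k) * q ^ (4 * k)))
            * coord x ((k, 0), 2) else 0)"
        by (simp add: K2 coord_chern3_op[OF q])
      then show ?thesis
        unfolding w2 by (simp add: p r coord_diag_op[OF bound])
    qed
  qed
qed

theorem proposition6:
  fixes q :: real
  assumes "0 < q" and "q < 1"
  shows "chern3_pairing q (suq2_V q) = of_real q \<and> chern3_pairing q (suq2_V q) \<noteq> 0"
proof -
  have "op_trace (op_K2 q \<circ> chern3_op q (suq2_V q)) = 16 * of_real q"
    using has_sum_chern3_weight[OF assms]
    by (simp only: op_K2_chern3_op[OF assms] op_trace_diag_op[OF has_sum_imp_summable] infsumI)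
  \<comment> \<open>The normalization \<open>(- 1) ^ 2 / 2 ^ 4\<close> cancels the factor 16, and
    \<open>0 < q\<close> gives nontriviality.\<close>
  then show ?thesis
    using assms by (simp add: chern3_pairing_def)
qed

end
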